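(* Let $\nu>0$ be such that the sublevel set $\mathcal{K}_\nu:=\{K\in\mathcal{K}\mid J(K)\le \nu\}$ is nonempty. Then there exists a constant $m_\nu>0$ such that the function $$K\;\mapsto\; J(K)+\frac{m_\nu}{2}\|K\|_F^2$$ is convex over any nonempty convex subset $V\subset\mathcal{K}_\nu$.
   Context: Fix $A\in\mathbb{R}^{n_x\times n_x}$, $B\in\mathbb{R}^{n_x\times n_u}$, $B_w\in\mathbb{R}^{n_x\times n_w}$, $C\in\mathbb{R}^{n_y\times n_x}$ and symmetric matrices $Q\in\mathbb{R}^{n_x\times n_x}$, $R\in\mathbb{R}^{n_u\times n_u}$. Standing assumptions: $(A,B)$ is stabilizable; $B_w$ and $C$ have full row rank; $Q$ and $R$ are positive definite; and the set of stabilizing static output-feedback gains $$\mathcal{K}:=\{K\in\mathbb{R}^{n_u\times n_y}\mid \text{all eigenvalues of } A+BKC \text{ have modulus}<1\}$$ is nonempty. For $K\in\mathcal{K}$ and $\omega\in[0,2\pi]$ let $$\mathbf{T}_{zw}(K,\omega)=\begin{bmatrix}Q^{1/2}\\ R^{1/2}KC\end{bmatrix}\left(e^{j\omega}I-(A+BKC)\right)^{-1}B_w,$$ where $j$ is the imaginary unit. The $\mathcal{H}_\infty$ cost is $J(K):=\max_{\omega\in[0,2\pi]}\sigma_{\max}(\mathbf{T}_{zw}(K,\omega))$ for $K\in\mathcal{K}$, where $\sigma_{\max}$ is the largest singular value. $\|\cdot\|_F$ is the Frobenius norm. *)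

theory Defs
  imports "HOL-Analysis.Analysis"
begin

abbreviation complex_matrix :: "real^'n^'m \<Rightarrow> complex^'n^'m" where
  "complex_matrix \<equiv> map_matrix complex_of_real"

definition eigenvalue :: "complex^'n^'n \<Rightarrow> complex \<Rightarrow> bool" where
  "eigenvalue M l \<longleftrightarrow> (\<exists>v. v \<noteq> 0 \<and> M *v v = l *s v)"

definition schur_stable :: "real^'n^'n \<Rightarrow> bool" where
  "schur_stable M \<longleftrightarrow> (\<forall>l. eigenvalue (complex_matrix M) l \<longrightarrow> cmod l < 1)"

definition stabilizable :: "real^'nx^'nx \<Rightarrow> real^'nu^'nx \<Rightarrow> bool" where
  "stabilizable A B \<longleftrightarrow> (\<exists>F :: real^'nx^'nu. schur_stable (A + B ** F))"

definition full_row_rank :: "real^'n^'m \<Rightarrow> bool" where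
  "full_row_rank M \<longleftrightarrow> rank M = CARD('m)"

definition symmetric_matrix :: "real^'n^'n \<Rightarrow> bool" where
  "symmetric_matrix M \<longleftrightarrow> transpose M = M"

definition pos_definite :: "real^'n^'n \<Rightarrow> bool" where
  "pos_definite M \<longleftrightarrow> (\<forall>x. x \<noteq> 0 \<longrightarrow> 0 < x \<bullet> (M *v x))"

definition pos_semidefinite :: "real^'n^'n \<Rightarrow> bool" where
  "pos_semidefinite M \<longleftrightarrow> (\<forall>x. 0 \<le> x \<bullet> (M *v x))"

definition sqrt_matrix :: "real^'n^'n \<Rightarrow> real^'n^'n" where
  "sqrt_matrix M = (THE S. symmetric_matrix S \<and> pos_semidefinite S \<and> S ** S = M)"

definition adjoint_matrix :: "complex^'n^'m \<Rightarrow> complex^'m^'n" where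
  "adjoint_matrix M = map_matrix cnj (transpose M)"

(* This set always has one element per column of M, counted with multiplicity, so for a wide
   matrix it contains extra zeros. They do not affect the maximum. *)
definition singular_values :: "complex^'n^'m \<Rightarrow> real set" where
  "singular_values M = {s. 0 \<le> s \<and> eigenvalue (adjoint_matrix M ** M) (complex_of_real (s\<^sup>2))}"

definition sigma_max :: "complex^'n^'m \<Rightarrow> real" where
  "sigma_max M = Max (singular_values M)"

(* Block column matrix with M on top of N; the row indices form the disjoint sum type. *)
definition stack_rows :: "'a^'n^'m \<Rightarrow> 'a^'n^'k \<Rightarrow> 'a^'n^('m + 'k)" where
  "stack_rows M N = (\<chi> i. case i of Inl a \<Rightarrow> M $ a | Inr b \<Rightarrow> N $ b)"

definition stabilizing_gains ::
    "real^'nx^'nx \<Rightarrow> real^'nu^'nx \<Rightarrow> real^'nx^'ny \<Rightarrow> (real^'ny^'nu) set" where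
  "stabilizing_gains A B C = {K. schur_stable (A + B ** K ** C)}"

definition T_zw ::
    "real^'nx^'nx \<Rightarrow> real^'nu^'nx \<Rightarrow> real^'nw^'nx \<Rightarrow> real^'nx^'ny \<Rightarrow>
     real^'nx^'nx \<Rightarrow> real^'nu^'nu \<Rightarrow> real^'ny^'nu \<Rightarrow> real \<Rightarrow> complex^'nw^('nx + 'nu)" where
  "T_zw A B Bw C Q R K \<omega> =
     complex_matrix (stack_rows (sqrt_matrix Q) (sqrt_matrix R ** K ** C)) **
     matrix_inv (mat (exp (\<i> * complex_of_real \<omega>)) - complex_matrix (A + B ** K ** C)) **
     complex_matrix Bw"

definition hinf_cost ::
    "real^'nx^'nx \<Rightarrow> real^'nu^'nx \<Rightarrow> real^'nw^'nx \<Rightarrow> real^'nx^'ny \<Rightarrow>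
     real^'nx^'nx \<Rightarrow> real^'nu^'nu \<Rightarrow> real^'ny^'nu \<Rightarrow> real" where
  "hinf_cost A B Bw C Q R K =
     (GREATEST s. s \<in> (\<lambda>\<omega>. sigma_max (T_zw A B Bw C Q R K \<omega>)) ` {0..2 * pi})"

definition hinf_sublevel ::
    "real^'nx^'nx \<Rightarrow> real^'nu^'nx \<Rightarrow> real^'nw^'nx \<Rightarrow> real^'nx^'ny \<Rightarrow>
     real^'nx^'nx \<Rightarrow> real^'nu^'nu \<Rightarrow> real \<Rightarrow> (real^'ny^'nu) set" where
  "hinf_sublevel A B Bw C Q R \<nu> =
     {K \<in> stabilizing_gains A B C. hinf_cost A B Bw C Q R K \<le> \<nu>}"

(* The library norm on real matrices is the Frobenius norm. *)
lemma norm_matrix_frobenius: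
  fixes K :: "real^'n^'m"
  shows "norm K = sqrt (\<Sum>i\<in>UNIV. \<Sum>j\<in>UNIV. (K $ i $ j)\<^sup>2)"
  by (simp add: norm_vec_def L2_set_def sum_nonneg)

end

theory Submission
  imports Defs
begin

text \<open>
  The function \<open>J K + m / 2 * (norm K)\<^sup>2\<close> is convex on \<open>V\<close> iff \<open>J\<close> exceeds each of its chords by at most
  \<open>m / 2 * t * (1 - t) * (norm (K1 - K2))\<^sup>2\<close>, because the squared norm lies below its chord by exactly
  \<open>t * (1 - t) * (norm (K1 - K2))\<^sup>2\<close> (\<open>norm_convex_combination_squared\<close>). The task is to find such an
  estimate with one \<open>m\<close> for the whole sublevel set.

  Write \<open>G\<close> for the resolvent of \<open>A + B K C\<close> at a point of the unit circle and \<open>L\<close> for the output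
  matrix, so that the transfer function is \<open>L G Bw\<close>. With \<open>E = K1 - K2\<close>, \<open>F = B E C\<close> and \<open>D\<close> the
  change of \<open>L\<close> in the direction \<open>E\<close>, applying the resolvent identity twice gives the exact formula
  \<open>(1 - t) L1 G1 + t L2 G2 - Lt Gt = t (1 - t) (D + L1 G1 F) G2 F Gt\<close>
  (\<open>segment_output_identity\<close>). Both \<open>D\<close> and \<open>F\<close> are linear in \<open>E\<close>, so it remains to bound \<open>L G\<close> and
  \<open>G\<close> uniformly over frequencies and over the sublevel set. The inequality \<open>J K \<le> \<nu>\<close>
  does this (\<open>sublevel_uniform_bounds\<close>): it bounds \<open>L G Bw\<close>, the full row rank of \<open>Bw\<close> allows \<open>Bw\<close> to be
  cancelled, and \<open>Q > 0\<close> allows the block \<open>sqrt_matrix Q\<close> of \<open>L\<close> to be cancelled. Since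
  \<^const>\<open>sigma_max\<close> is a norm and \<open>J\<close> is a maximum over frequencies, the estimate passes
  to \<open>J\<close> (\<open>hinf_cost_segment_bound\<close>).

  The remaining work connects the definitions with these analytic facts: the largest singular value
  is the operator norm (\<open>sigma_max_eq_onorm\<close>), the described matrix root exists and is unique
  (\<open>sqrt_matrix_pos_definite\<close>), and the maximum over frequencies is attained (\<open>hinf_cost_attained\<close>).
\<close>

section \<open>Self-adjoint operators and matrix square roots\<close>

text \<open>
  A maximizer of the quadratic form of \<open>P\<close> on the unit sphere of \<open>W\<close> is an eigenvector. Stating this
  over an abstract Euclidean space serves real and complex matrices alike: \<open>complex^'n\<close> is Euclidean
  for the real part of its Hermitian product, and a Hermitian matrix is self-adjoint for that
  product. The invariant subspace \<open>W\<close> allows eigenvectors to be split off one at a time.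
\<close>

lemma selfadjoint_maximal_eigenvector:
  fixes P :: "'a::euclidean_space \<Rightarrow> 'a"
  assumes lin: "linear P" and sub: "subspace W" and ne: "W \<noteq> {0}"
    and inv: "\<And>x. x \<in> W \<Longrightarrow> P x \<in> W"
    and self: "\<And>x y. P x \<bullet> y = x \<bullet> P y"
  obtains x where "x \<in> W" "norm x = 1" "P x = (x \<bullet> P x) *\<^sub>R x"
    "\<And>y. y \<in> W \<Longrightarrow> y \<bullet> P y \<le> (x \<bullet> P x) * (y \<bullet> y)"
proof -
  interpret P: linear P by (fact lin)
  define K where "K = sphere 0 1 \<inter> W"
  have comp: "compact K"
    unfolding K_def by (intro compact_Int_closed compact_sphere closed_subspace sub)
  obtain w where w: "w \<in> W" "w \<noteq> 0" using ne subspace_0[OF sub] by blast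
  have normed: "y /\<^sub>R norm y \<in> K" if "y \<in> W" "y \<noteq> 0" for y
    using that by (simp add: K_def subspace_scale[OF sub])
  have "K \<noteq> {}" using normed[OF w] by blast
  moreover have "continuous_on K (\<lambda>x. x \<bullet> P x)"
    by (intro continuous_intros linear_continuous_on linear_conv_bounded_linear[THEN iffD1] lin)
  ultimately obtain x where x: "x \<in> K" and mx: "\<And>y. y \<in> K \<Longrightarrow> y \<bullet> P y \<le> x \<bullet> P x"
    using continuous_attains_sup[OF comp] by blast
  define l where "l = x \<bullet> P x"
  have xW: "x \<in> W" and n1: "norm x = 1" using x by (auto simp: K_def)
  have le: "y \<bullet> P y \<le> l * (y \<bullet> y)" if "y \<in> W" for y
  proof (cases "y = 0")
    case False
    from mx[OF normed[OF that False]]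
    have "(y \<bullet> P y) / (norm y)\<^sup>2 \<le> l"
      by (simp add: P.scaleR l_def power2_eq_square divide_simps)
    then show ?thesis using False by (simp add: field_simps dot_square_norm)
  qed (simp add: P.zero)
  define u where "u = l *\<^sub>R x - P x"
  have uW: "u \<in> W" unfolding u_def
    by (intro subspace_diff sub subspace_scale inv xW)
  have ux: "u \<bullet> x = 0"
  proof -
    have "u \<bullet> x = l * (x \<bullet> x) - P x \<bullet> x" by (simp add: u_def inner_diff_left)
    also have "P x \<bullet> x = l" by (simp add: l_def inner_commute)
    finally show ?thesis using n1 by (simp add: dot_square_norm)
  qed
  \<comment> \<open>The form \<open>l * (y \<bullet> y) - y \<bullet> P y\<close> is nonnegative on \<open>W\<close> and vanishes at \<open>x\<close>, so its
    derivative at \<open>x\<close> in the direction \<open>u\<close>, which is \<open>2 * (u \<bullet> u)\<close>, must vanish.\<close>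
  define c where "c = l * (u \<bullet> u) - u \<bullet> P u"
  have key: "0 \<le> 2 * s * (u \<bullet> u) + s\<^sup>2 * c" for s
  proof -
    have W: "x + s *\<^sub>R u \<in> W" by (intro subspace_add sub subspace_scale uW xW)
    have xx: "x \<bullet> x = 1" using n1 by (simp add: dot_square_norm)
    have sq: "(x + s *\<^sub>R u) \<bullet> (x + s *\<^sub>R u) = 1 + s\<^sup>2 * (u \<bullet> u)"
      using ux by (simp add: inner_add_left inner_add_right xx inner_commute[of x u] power2_eq_square)
    have form: "(x + s *\<^sub>R u) \<bullet> P (x + s *\<^sub>R u)
        = l + s * (x \<bullet> P u) + s * (u \<bullet> P x) + s\<^sup>2 * (u \<bullet> P u)"
      by (simp add: P.add P.scaleR inner_add_left inner_add_right l_def power2_eq_square algebra_simps)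
    have "l + s * (x \<bullet> P u) + s * (u \<bullet> P x) + s\<^sup>2 * (u \<bullet> P u)
        \<le> l * (1 + s\<^sup>2 * (u \<bullet> u))"
      using le[OF W] unfolding sq form .
    moreover have "x \<bullet> P u = u \<bullet> P x" using self[of x u] by (simp add: inner_commute)
    moreover have "u \<bullet> P x = - (u \<bullet> u)"
      using ux by (simp add: u_def inner_diff_left inner_diff_right inner_commute)
    ultimately show ?thesis by (simp add: c_def algebra_simps)
  qed
  have "u \<bullet> u = 0"
  proof (rule ccontr)
    assume "u \<bullet> u \<noteq> 0"
    then have pos: "u \<bullet> u > 0" by simp
    \<comment> \<open>A step \<open>s = - e\<close> so small that the linear term of \<open>key\<close> dominates the quadratic one.\<close>
    define e where "e = (u \<bullet> u) / (1 + \<bar>c\<bar>)"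
    have e: "e > 0" using pos by (simp add: e_def)
    have "e * c \<le> e * (1 + \<bar>c\<bar>)" using e by (intro mult_left_mono) auto
    also have "\<dots> = u \<bullet> u" by (simp add: e_def)
    finally have "e * c \<le> u \<bullet> u" .
    moreover have "0 \<le> e * (e * c - 2 * (u \<bullet> u))"
      using key[of "-e"] by (simp add: power2_eq_square algebra_simps)
    ultimately show False using e pos by (simp add: zero_le_mult_iff)
  qed
  then have "P x = l *\<^sub>R x" by (simp add: u_def)
  from that[OF xW n1 this[unfolded l_def] le[unfolded l_def]] show thesis .
qed

text \<open>
  This is the spectral theorem. An orthonormal set of eigenvectors of maximal cardinality spans the
  space, since otherwise its orthogonal complement is a nonzero invariant subspace and contains
  another eigenvector.
\<close>

lemma selfadjoint_orthonormal_eigenbasis: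
  fixes P :: "'a::euclidean_space \<Rightarrow> 'a"
  assumes lin: "linear P" and self: "\<And>x y. P x \<bullet> y = x \<bullet> P y"
  obtains B where "finite B" "pairwise orthogonal B" "\<And>b. b \<in> B \<Longrightarrow> norm b = 1"
    "span B = UNIV" "\<And>b. b \<in> B \<Longrightarrow> P b = (b \<bullet> P b) *\<^sub>R b"
proof -
  define ok where "ok = (\<lambda>B. pairwise orthogonal B \<and> (\<forall>b\<in>B. norm b = 1 \<and> P b = (b \<bullet> P b) *\<^sub>R b))"
  have fin: "finite B \<and> card B \<le> DIM('a)" if "ok B" for B
  proof -
    have "0 \<notin> B" using that by (auto simp: ok_def)
    then have "independent B" using that pairwise_orthogonal_independent by (auto simp: ok_def)
    then show ?thesis using independent_bound by blast
  qed
  have "ok {}" by (simp add: ok_def)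
  then obtain B where B: "ok B" and mx: "\<And>C. ok C \<Longrightarrow> card C \<le> card B"
    using ex_has_greatest_nat[of ok "{}" card "DIM('a) + 1"] fin by (metis le_imp_less_Suc Suc_eq_plus1 less_imp_le)
  have "span B = UNIV"
  proof (rule ccontr)
    assume "span B \<noteq> UNIV"
    then obtain w where w: "w \<noteq> 0" "\<And>y. y \<in> span B \<Longrightarrow> orthogonal w y"
      using orthogonal_to_subspace_exists_gen[of B UNIV] by auto
    define W where "W = {x. \<forall>b\<in>B. x \<bullet> b = 0}"
    have sub: "subspace W" by (auto simp: W_def subspace_def inner_add_left)
    have "w \<in> W" using w by (auto simp: W_def orthogonal_def span_base)
    then have "W \<noteq> {0}" using w by auto
    moreover have "P x \<in> W" if "x \<in> W" for x
    proof -
      have "P x \<bullet> b = 0" if b: "b \<in> B" for b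
      proof -
        have "P b = (b \<bullet> P b) *\<^sub>R b" using B b by (auto simp: ok_def)
        then have "P x \<bullet> b = (b \<bullet> P b) * (x \<bullet> b)" using self[of x b] by (metis inner_scaleR_right)
        then show ?thesis using \<open>x \<in> W\<close> b by (simp add: W_def)
      qed
      then show ?thesis by (simp add: W_def)
    qed
    ultimately obtain x where x: "x \<in> W" "norm x = 1" "P x = (x \<bullet> P x) *\<^sub>R x"
      using selfadjoint_maximal_eigenvector[OF lin sub _ _ self] by metis
    have "x \<notin> B" using x by (auto simp: W_def)
    moreover have "ok (insert x B)"
      using B x by (auto simp: ok_def W_def pairwise_insert orthogonal_def inner_commute)
    ultimately show False using mx[of "insert x B"] fin[OF B] by simp
  qed
  then show thesis using B fin[OF B] that by (auto simp: ok_def)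
qed

lemma symmetric_matrix_iff_selfadjoint:
  "symmetric_matrix M \<longleftrightarrow> (\<forall>x y. (M *v x) \<bullet> y = x \<bullet> (M *v y))"
proof -
  have t: "(transpose M *v x) \<bullet> y = x \<bullet> (M *v y)" for x y
    by (metis dot_lmul_matrix transpose_matrix_vector)
  show ?thesis
  proof
    assume "symmetric_matrix M"
    then show "\<forall>x y. (M *v x) \<bullet> y = x \<bullet> (M *v y)" using t by (simp add: symmetric_matrix_def)
  next
    assume r: "\<forall>x y. (M *v x) \<bullet> y = x \<bullet> (M *v y)"
    then have "transpose M *v x = M *v x" for x
      using t by (intro vector_eq_ldot[THEN iffD1]) (metis inner_commute)
    then show "symmetric_matrix M" by (simp add: symmetric_matrix_def matrix_eq)
  qed
qed

text \<open>
  Since \<^const>\<open>sqrt_matrix\<close> is a definite description, both existence and uniqueness of the positive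
  semidefinite root are needed. Existence takes roots of the eigenvalues on an orthonormal
  eigenbasis; for uniqueness, every root is seen to act on that same basis in the same way.
\<close>

lemma sqrt_matrix_pos_definite:
  fixes Q :: "real^'n^'n"
  assumes sym: "symmetric_matrix Q" and pos: "pos_definite Q"
  shows "sqrt_matrix Q ** sqrt_matrix Q = Q"
proof -
  let ?P = "\<lambda>S. symmetric_matrix S \<and> pos_semidefinite S \<and> S ** S = Q"
  have self: "(Q *v x) \<bullet> y = x \<bullet> (Q *v y)" for x y
    using sym by (simp add: symmetric_matrix_iff_selfadjoint)
  obtain B where B: "finite B" "pairwise orthogonal B" "\<And>b. b \<in> B \<Longrightarrow> norm b = 1"
    "span B = UNIV" "\<And>b. b \<in> B \<Longrightarrow> Q *v b = (b \<bullet> (Q *v b)) *\<^sub>R b"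
    using selfadjoint_orthonormal_eigenbasis[of "(*v) Q", OF _ self]
      matrix_vector_mul_linear[of Q] by metis
  define r where "r = (\<lambda>b. sqrt (b \<bullet> (Q *v b)))"
  have b_ne0: "b \<noteq> 0" if "b \<in> B" for b using B(3)[OF that] by auto
  have rpos: "r b > 0" if "b \<in> B" for b
    using pos b_ne0[OF that] by (simp add: r_def pos_definite_def)
  have Qb: "Q *v b = (r b)\<^sup>2 *\<^sub>R b" if "b \<in> B" for b
    using B(5)[OF that] rpos[OF that] by (simp add: r_def)
  have eq_on_B: "M = N" if "\<And>b. b \<in> B \<Longrightarrow> M *v b = N *v b" for M N :: "real^'n^'n"
  proof -
    have "M *v x = N *v x" for x
      using linear_eq_on_span[OF matrix_vector_mul_linear[of M] matrix_vector_mul_linear[of N], of B x]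
        that B(4) by auto
    then show ?thesis by (simp add: matrix_eq)
  qed
  define f where "f = (\<lambda>x. \<Sum>b\<in>B. (r b * (x \<bullet> b)) *\<^sub>R b)"
  have linf: "linear f"
    by (rule linearI) (simp_all add: f_def inner_add_left algebra_simps sum.distrib scaleR_sum_right)
  have fb: "f c = r c *\<^sub>R c" if c: "c \<in> B" for c
  proof -
    have "(r b * (c \<bullet> b)) *\<^sub>R b = (if b = c then r c *\<^sub>R c else 0)" if b: "b \<in> B" for b
      using B(2,3) b c by (auto simp: pairwise_def orthogonal_def dot_square_norm)
    then have "f c = (\<Sum>b\<in>B. if b = c then r c *\<^sub>R c else 0)" by (simp add: f_def)
    then show ?thesis using B(1) c by simp
  qed
  define S where "S = matrix f"
  have Sf: "S *v x = f x" for x by (simp add: S_def linf matrix_works linear_matrix_vector_mul_eq)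
  have "symmetric_matrix S"
    by (simp add: symmetric_matrix_iff_selfadjoint Sf f_def inner_sum_left inner_sum_right inner_commute mult_ac)
  moreover have "pos_semidefinite S"
    using less_imp_le[OF rpos] unfolding pos_semidefinite_def Sf f_def
    by (auto simp: inner_sum_right mult.assoc intro!: sum_nonneg mult_nonneg_nonneg[OF _ zero_le_square])
  moreover have "S ** S = Q"
    by (rule eq_on_B)
      (simp add: matrix_vector_mul_assoc[symmetric] Sf fb Qb linear_scale[OF linf] power2_eq_square)
  ultimately have ex: "?P S" by blast
  have "T = S" if T: "?P T" for T
  proof (rule eq_on_B)
    fix b assume b: "b \<in> B"
    \<comment> \<open>\<open>(T + r b) (T - r b) b = (Q - (r b)\<^sup>2) b = 0\<close>, and \<open>T + r b\<close> is positive definite.\<close>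
    define u where "u = T *v b - r b *\<^sub>R b"
    have "T *v (T *v b) = (r b)\<^sup>2 *\<^sub>R b"
      using T Qb[OF b] by (simp add: matrix_vector_mul_assoc)
    then have "T *v u = - (r b *\<^sub>R u)"
      by (simp add: u_def matrix_vector_mult_diff_distrib matrix_vector_mult_scaleR algebra_simps power2_eq_square)
    moreover have "0 \<le> u \<bullet> (T *v u)" using T by (simp add: pos_semidefinite_def)
    ultimately have "r b * (u \<bullet> u) \<le> 0" by simp
    moreover have "0 \<le> u \<bullet> u" by simp
    ultimately have "u \<bullet> u = 0" using rpos[OF b] by (simp add: mult_le_0_iff)
    then have "u = 0" by simp
    then show "T *v b = S *v b" by (simp add: u_def Sf fb b)
  qed
  with ex have "\<exists>!S. ?P S" by metis
  from theI'[OF this] show ?thesis by (simp add: sqrt_matrix_def)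
qed

section \<open>The largest singular value as a norm\<close>

lemma inner_adjoint_matrix:
  fixes M :: "complex^'n^'m"
  shows "(M *v x) \<bullet> y = x \<bullet> (adjoint_matrix M *v y)"
proof -
  have c: "(a * b) \<bullet> z = b \<bullet> (cnj a * z)" for a b z :: complex
    by (simp add: inner_complex_def algebra_simps)
  have "(M *v x) \<bullet> y = (\<Sum>i\<in>UNIV. \<Sum>j\<in>UNIV. x$j \<bullet> (cnj (M$i$j) * y$i))"
    by (simp add: inner_vec_def matrix_vector_mult_def inner_sum_left c)
  also have "\<dots> = (\<Sum>j\<in>UNIV. \<Sum>i\<in>UNIV. x$j \<bullet> (cnj (M$i$j) * y$i))"
    by (rule sum.swap)
  also have "\<dots> = x \<bullet> (adjoint_matrix M *v y)"
    by (simp add: inner_vec_def matrix_vector_mult_def inner_sum_right adjoint_matrix_def transpose_def)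
  finally show ?thesis .
qed

lemma complex_smult_of_real: "complex_of_real c *s v = c *\<^sub>R v"
  by (simp add: vec_eq_iff scaleR_conv_of_real[symmetric])

text \<open>
  The maximal eigenvector of the Gram operator \<open>adjoint_matrix M ** M\<close> is a unit vector on which \<open>M\<close>
  attains its operator norm, and its eigenvalue is the square of that norm. The set of singular
  values is finite, so that its \<^const>\<open>Max\<close> is meaningful, because eigenvectors for distinct
  eigenvalues are orthogonal and hence independent.
\<close>

lemma sigma_max_eq_onorm:
  fixes M :: "complex^'n^'m"
  shows "sigma_max M = onorm ((*v) M)"
proof -
  define P where "P = (\<lambda>x. (adjoint_matrix M ** M) *v x)"
  have lin: "linear P" unfolding P_def by (rule matrix_vector_mul_linear)
  have form: "x \<bullet> P y = (M *v x) \<bullet> (M *v y)" for x y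
    by (simp add: P_def inner_adjoint_matrix matrix_vector_mul_assoc[symmetric])
  have self: "P x \<bullet> y = x \<bullet> P y" for x y
    by (metis form inner_commute)
  have sv: "s \<in> singular_values M \<longleftrightarrow> 0 \<le> s \<and> (\<exists>v. v \<noteq> 0 \<and> P v = s\<^sup>2 *\<^sub>R v)" for s
    by (simp add: singular_values_def eigenvalue_def P_def complex_smult_of_real flip: of_real_power)
  \<comment> \<open>The space is nontrivial because the index type is nonempty.\<close>
  have "axis undefined 1 \<noteq> (0::complex^'n)" by (simp add: axis_eq_0_iff)
  then have "(UNIV :: (complex^'n) set) \<noteq> {0}" by blast
  then obtain x where x: "norm x = 1" "P x = (x \<bullet> P x) *\<^sub>R x"
    and mx: "\<And>y. y \<bullet> P y \<le> (x \<bullet> P x) * (y \<bullet> y)"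
    using selfadjoint_maximal_eigenvector[OF lin subspace_UNIV _ _ self] by (metis UNIV_I)
  define s where "s = norm (M *v x)"
  have s2: "x \<bullet> P x = s\<^sup>2" by (simp add: form s_def dot_square_norm)
  have "s \<in> singular_values M" using x s2 by (auto simp: sv s_def intro!: exI[of _ x])
  have bnd: "norm (M *v y) \<le> s * norm y" for y
  proof (rule power2_le_imp_le)
    show "(norm (M *v y))\<^sup>2 \<le> (s * norm y)\<^sup>2"
      using mx[of y] unfolding s2 by (simp add: form dot_square_norm power_mult_distrib)
  qed (simp add: s_def)
  have up: "t \<le> s" if t: "t \<in> singular_values M" for t
  proof -
    from t obtain v where v: "v \<noteq> 0" "P v = t\<^sup>2 *\<^sub>R v" "0 \<le> t" by (auto simp: sv)
    have "t\<^sup>2 * (v \<bullet> v) = v \<bullet> P v" by (simp add: v)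
    also have "\<dots> \<le> s\<^sup>2 * (v \<bullet> v)" using mx[of v] by (simp add: s2)
    finally have "t\<^sup>2 \<le> s\<^sup>2" using v by (simp add: mult_le_cancel_right)
    then show ?thesis by (rule power2_le_imp_le) (simp add: s_def)
  qed
  have fin: "finite (singular_values M)"
  proof -
    have "\<forall>t. \<exists>v. t \<in> singular_values M \<longrightarrow> v \<noteq> 0 \<and> P v = t\<^sup>2 *\<^sub>R v" by (auto simp: sv)
    then obtain g where g: "\<And>t. t \<in> singular_values M \<Longrightarrow> g t \<noteq> 0 \<and> P (g t) = t\<^sup>2 *\<^sub>R g t"
      by metis
    have orth: "g t \<bullet> g u = 0" if "t \<in> singular_values M" "u \<in> singular_values M" "t \<noteq> u" for t u
    proof -
      have "t\<^sup>2 * (g t \<bullet> g u) = u\<^sup>2 * (g t \<bullet> g u)"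
        using self[of "g t" "g u"] g that by simp
      moreover have "t\<^sup>2 \<noteq> u\<^sup>2" using that by (auto simp: sv power2_eq_iff_nonneg)
      ultimately show ?thesis by simp
    qed
    have "inj_on g (singular_values M)"
      by (rule inj_onI) (metis orth g inner_eq_zero_iff)
    moreover have "finite (g ` singular_values M)"
    proof -
      have "pairwise orthogonal (g ` singular_values M)"
        by (auto simp: pairwise_def orthogonal_def) (metis orth)
      moreover have "0 \<notin> g ` singular_values M" using g by auto
      ultimately have "independent (g ` singular_values M)"
        by (rule pairwise_orthogonal_independent)
      then show ?thesis using independent_bound by blast
    qed
    ultimately show ?thesis by (rule finite_imageD[rotated])
  qed
  have "sigma_max M = s"
    unfolding sigma_max_def using fin up \<open>s \<in> singular_values M\<close> by (intro Max_eqI) auto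
  moreover have "onorm ((*v) M) = s"
  proof (rule antisym)
    show "onorm ((*v) M) \<le> s" by (rule onorm_le) (rule bnd)
    show "s \<le> onorm ((*v) M)"
      using onorm[OF matrix_vector_mul_bounded_linear, of M x] x by (simp add: s_def)
  qed
  ultimately show ?thesis by simp
qed

lemma norm_le_sigma_max:
  fixes M :: "complex^'n^'m"
  shows "norm (M *v x) \<le> sigma_max M * norm x"
  unfolding sigma_max_eq_onorm by (rule onorm) (rule matrix_vector_mul_bounded_linear)

lemma sigma_max_le:
  fixes M :: "complex^'n^'m"
  assumes "\<And>x. norm (M *v x) \<le> c * norm x"
  shows "sigma_max M \<le> c"
  unfolding sigma_max_eq_onorm by (rule onorm_le) (rule assms)

lemma sigma_max_nonneg: "0 \<le> sigma_max M"
  unfolding sigma_max_eq_onorm by (rule onorm_pos_le) (rule matrix_vector_mul_bounded_linear)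

lemma mat_vector_mult: "mat c *v v = c *s (v :: 'a::semiring_1^'n)"
  by (simp add: vec_eq_iff matrix_vector_mult_def mat_def if_distrib[of "\<lambda>a. a * _"] cong: if_cong)

lemma norm_complex_smult: "norm (z *s v) = cmod z * norm (v :: complex^'n)"
  by (simp add: norm_vec_def norm_mult L2_set_right_distrib)

lemma sigma_max_mult_le: "sigma_max (M ** N) \<le> sigma_max M * sigma_max N"
proof (rule sigma_max_le)
  fix x
  have "norm (M *v (N *v x)) \<le> sigma_max M * norm (N *v x)" by (rule norm_le_sigma_max)
  also have "\<dots> \<le> sigma_max M * (sigma_max N * norm x)"
    by (intro mult_left_mono norm_le_sigma_max sigma_max_nonneg)
  finally show "norm (M ** N *v x) \<le> sigma_max M * sigma_max N * norm x"
    by (simp add: matrix_vector_mul_assoc mult.assoc)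
qed

lemma sigma_max_add_le: "sigma_max (M + N) \<le> sigma_max M + sigma_max N"
proof (rule sigma_max_le)
  fix x
  have "norm ((M + N) *v x) \<le> norm (M *v x) + norm (N *v x)"
    by (simp add: matrix_vector_mult_add_rdistrib norm_triangle_ineq)
  also have "\<dots> \<le> sigma_max M * norm x + sigma_max N * norm x"
    by (intro add_mono norm_le_sigma_max)
  finally show "norm ((M + N) *v x) \<le> (sigma_max M + sigma_max N) * norm x"
    by (simp add: algebra_simps)
qed

lemma sigma_max_scaleR: "sigma_max (c *\<^sub>R M) = \<bar>c\<bar> * sigma_max (M :: complex^'n^'m)"
proof -
  have *: "(*v) (c *\<^sub>R M) = (\<lambda>x. c *\<^sub>R (M *v x))"
    by (auto simp: fun_eq_iff vec_eq_iff matrix_vector_mult_def scaleR_sum_right)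
  show ?thesis
    unfolding sigma_max_eq_onorm * by (rule onorm_scaleR) (rule matrix_vector_mul_bounded_linear)
qed

lemma sigma_max_mat_le: "sigma_max (mat z) \<le> cmod z"
  by (rule sigma_max_le) (simp add: mat_vector_mult norm_complex_smult)

lemma abs_sigma_max_diff_le: "\<bar>sigma_max M - sigma_max N\<bar> \<le> sigma_max (M - N)"
proof -
  have "sigma_max (N - M) = sigma_max (M - N)"
    using sigma_max_scaleR[of "-1" "M - N"] by simp
  then show ?thesis
    using sigma_max_add_le[of "M - N" N] sigma_max_add_le[of "N - M" M] by simp
qed

lemma sigma_max_linear_bounded:
  fixes \<Phi> :: "'a::euclidean_space \<Rightarrow> complex^'n^'m"
  assumes lin: "linear \<Phi>"
  shows "\<exists>c\<ge>0. \<forall>E. sigma_max (\<Phi> E) \<le> c * norm E"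
proof -
  interpret \<Phi>: linear \<Phi> by (fact lin)
  have *: "(c *\<^sub>R M) *v x = c *\<^sub>R (M *v x)" for c and M :: "complex^'n^'m" and x
    by (simp add: vec_eq_iff matrix_vector_mult_def scaleR_sum_right)
  have "bilinear (\<lambda>E v. \<Phi> E *v v)"
    by (auto simp: bilinear_def \<Phi>.add \<Phi>.scaleR matrix_vector_mult_add_rdistrib * intro!: linearI)
  from bilinear_bounded_pos[OF this]
  obtain c where "c > 0" "\<And>E v. norm (\<Phi> E *v v) \<le> c * norm E * norm v" by blast
  then show ?thesis by (intro exI[of _ c]) (auto intro: sigma_max_le)
qed

section \<open>Matrix algebra\<close>

lemma complex_matrix_mult: "complex_matrix (M ** N) = complex_matrix M ** complex_matrix N"
  by (simp add: vec_eq_iff matrix_matrix_mult_def)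

lemma complex_matrix_mat: "complex_matrix (mat c) = mat (complex_of_real c)"
  by (simp add: vec_eq_iff mat_def)

lemma complex_matrix_add: "complex_matrix (M + N) = complex_matrix M + complex_matrix N"
  by (simp add: vec_eq_iff)

lemma complex_matrix_diff: "complex_matrix (M - N) = complex_matrix M - complex_matrix N"
  by (simp add: vec_eq_iff)

lemma complex_matrix_scaleR: "complex_matrix (c *\<^sub>R M) = c *\<^sub>R complex_matrix M"
  by (simp add: vec_eq_iff scaleR_conv_of_real[where 'a = complex])

lemma stack_rows_add: "stack_rows (M + M') (N + N') = stack_rows M N + stack_rows M' N'"
  by (auto simp: vec_eq_iff stack_rows_def split: sum.split)

lemma stack_rows_scaleR: "stack_rows (c *\<^sub>R M) (c *\<^sub>R N) = c *\<^sub>R stack_rows M N"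
  by (auto simp: vec_eq_iff stack_rows_def split: sum.split)

lemma complex_matrix_stack_rows:
  "complex_matrix (stack_rows M N) = stack_rows (complex_matrix M) (complex_matrix N)"
  by (auto simp: vec_eq_iff stack_rows_def split: sum.split)

lemma norm_le_norm_stack_rows:
  fixes M :: "complex^'n^'m" and N :: "complex^'n^'k"
  shows "norm (M *v x) \<le> norm (stack_rows M N *v x)"
proof -
  have *: "(stack_rows M N *v x) $ Inl i = (M *v x) $ i" for i
    by (simp add: matrix_vector_mult_def stack_rows_def)
  have "(\<Sum>i\<in>UNIV. (norm ((M *v x) $ i))\<^sup>2)
      = (\<Sum>i\<in>range Inl. (norm ((stack_rows M N *v x) $ i))\<^sup>2)"
    by (simp add: sum.reindex * )
  also have "\<dots> \<le> (\<Sum>i\<in>UNIV. (norm ((stack_rows M N *v x) $ i))\<^sup>2)"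
    by (rule sum_mono2) auto
  finally show ?thesis by (simp add: norm_vec_def L2_set_def)
qed

lemma matrix_mult_scaleR_left: "(c *\<^sub>R M) ** N = c *\<^sub>R (M ** (N :: 'a::real_algebra_1^'n^'k))"
  by (rule scalar_matrix_assoc[symmetric])

lemma matrix_mult_scaleR_right: "M ** (c *\<^sub>R N) = c *\<^sub>R (M ** (N :: 'a::real_algebra_1^'n^'k))"
  by (simp add: vec_eq_iff matrix_matrix_mult_def scaleR_sum_right)

lemma matrix_mult_diff_left: "(M - M') ** N = M ** N - M' ** (N :: 'a::ring_1^'n^'k)"
  by (simp add: vec_eq_iff matrix_matrix_mult_def algebra_simps sum_subtractf)

lemma matrix_mult_diff_right: "N ** (M - M') = N ** M - N ** (M' :: 'a::ring_1^'n^'k)"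
  by (simp add: vec_eq_iff matrix_matrix_mult_def algebra_simps sum_subtractf)

lemma matrix_mult_add_left: "(M + M') ** N = M ** N + M' ** (N :: 'a::ring_1^'n^'k)"
  by (simp add: vec_eq_iff matrix_matrix_mult_def algebra_simps sum.distrib)

section \<open>Resolvents on the unit circle\<close>

definition resolvent :: "real^'n^'n \<Rightarrow> real \<Rightarrow> complex^'n^'n" where
  "resolvent M \<omega> = matrix_inv (mat (exp (\<i> * complex_of_real \<omega>)) - complex_matrix M)"

lemma unit_circle_pencil_injective:
  assumes "schur_stable M" "(mat (exp (\<i> * complex_of_real \<omega>)) - complex_matrix M) *v v = 0"
  shows "v = 0"
proof (rule ccontr)
  assume "v \<noteq> 0"
  with assms(2) have "eigenvalue (complex_matrix M) (exp (\<i> * complex_of_real \<omega>))"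
    by (auto simp: eigenvalue_def matrix_vector_mult_diff_rdistrib mat_vector_mult)
  with assms(1) show False by (auto simp: schur_stable_def)
qed

lemma resolvent_inverse:
  assumes "schur_stable M"
  shows "resolvent M \<omega> ** (mat (exp (\<i> * complex_of_real \<omega>)) - complex_matrix M) = mat 1"
    and "(mat (exp (\<i> * complex_of_real \<omega>)) - complex_matrix M) ** resolvent M \<omega> = mat 1"
proof -
  have "invertible (mat (exp (\<i> * complex_of_real \<omega>)) - complex_matrix M)"
    using unit_circle_pencil_injective[OF assms]
    by (auto simp: invertible_left_inverse matrix_left_invertible_ker)
  then show "resolvent M \<omega> ** (mat (exp (\<i> * complex_of_real \<omega>)) - complex_matrix M) = mat 1"
    and "(mat (exp (\<i> * complex_of_real \<omega>)) - complex_matrix M) ** resolvent M \<omega> = mat 1"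
    unfolding resolvent_def matrix_inv_def invertible_def by (metis (mono_tags, lifting) someI_ex)+
qed

lemma resolvent_identity:
  assumes M: "schur_stable M" and N: "schur_stable N"
  shows "resolvent M \<omega> - resolvent N \<omega> = resolvent M \<omega> ** complex_matrix (M - N) ** resolvent N \<omega>"
proof -
  let ?z = "mat (exp (\<i> * complex_of_real \<omega>)) :: complex^'a^'a"
  have "resolvent M \<omega> ** complex_matrix (M - N) ** resolvent N \<omega>
      = resolvent M \<omega> ** ((?z - complex_matrix N) - (?z - complex_matrix M)) ** resolvent N \<omega>"
    by (simp add: complex_matrix_diff)
  also have "\<dots> = resolvent M \<omega> ** ((?z - complex_matrix N) ** resolvent N \<omega>)
      - (resolvent M \<omega> ** (?z - complex_matrix M)) ** resolvent N \<omega>"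
    by (simp only: matrix_mult_diff_left matrix_mult_diff_right matrix_mul_assoc)
  also have "\<dots> = resolvent M \<omega> - resolvent N \<omega>"
    by (simp add: resolvent_inverse[OF M] resolvent_inverse[OF N])
  finally show ?thesis ..
qed

lemma resolvent_frequency_difference:
  assumes M: "schur_stable M"
  shows "resolvent M \<omega> - resolvent M \<theta> = resolvent M \<omega> **
    mat (exp (\<i> * complex_of_real \<theta>) - exp (\<i> * complex_of_real \<omega>)) ** resolvent M \<theta>"
proof -
  let ?z = "\<lambda>\<omega>. mat (exp (\<i> * complex_of_real \<omega>)) :: complex^'a^'a"
  have "mat (exp (\<i> * complex_of_real \<theta>) - exp (\<i> * complex_of_real \<omega>)) = ?z \<theta> - ?z \<omega>"
    by (simp add: vec_eq_iff mat_def)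
  then have "resolvent M \<omega> **
    mat (exp (\<i> * complex_of_real \<theta>) - exp (\<i> * complex_of_real \<omega>)) ** resolvent M \<theta>
      = resolvent M \<omega> ** ((?z \<theta> - complex_matrix M) - (?z \<omega> - complex_matrix M)) ** resolvent M \<theta>"
    by simp
  also have "\<dots> = resolvent M \<omega> ** ((?z \<theta> - complex_matrix M) ** resolvent M \<theta>)
      - (resolvent M \<omega> ** (?z \<omega> - complex_matrix M)) ** resolvent M \<theta>"
    by (simp only: matrix_mult_diff_left matrix_mult_diff_right matrix_mul_assoc)
  also have "\<dots> = resolvent M \<omega> - resolvent M \<theta>"
    by (simp add: resolvent_inverse[OF M])
  finally show ?thesis ..
qed

text \<open>
  The norm of \<open>(z I - M) v\<close> is continuous and positive on the compact product of the unit circle with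
  the unit sphere, so it has a positive minimum there, whose reciprocal bounds the resolvent. This
  bound depends on \<open>M\<close> and serves only to establish continuity in the frequency.
\<close>

lemma resolvent_bounded:
  fixes M :: "real^'n^'n"
  assumes M: "schur_stable M"
  shows "\<exists>c\<ge>0. \<forall>\<omega>\<in>{0..2 * pi}. \<forall>v. norm (resolvent M \<omega> *v v) \<le> c * norm v"
proof -
  define h where "h = (\<lambda>p :: real \<times> (complex^'n).
     norm (exp (\<i> * complex_of_real (fst p)) *s snd p - complex_matrix M *v snd p))"
  let ?K = "{0..2 * pi} \<times> sphere (0::complex^'n) 1"
  have h: "h (\<omega>, v) = norm ((mat (exp (\<i> * complex_of_real \<omega>)) - complex_matrix M) *v v)" for \<omega> v
    by (simp add: h_def matrix_vector_mult_diff_rdistrib mat_vector_mult)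
  have c1: "compact ?K" by (intro compact_Times compact_Icc compact_sphere)
  have "axis undefined 1 \<in> sphere (0::complex^'n) 1" by (simp add: norm_axis_1)
  then have c2: "?K \<noteq> {}" by auto
  have c3: "continuous_on ?K h"
    unfolding h_def vector_scalar_mult_def matrix_vector_mult_def by (intro continuous_intros)
  from continuous_attains_inf[OF c1 c2 c3]
  obtain p where p: "p \<in> ?K" and mn: "\<And>q. q \<in> ?K \<Longrightarrow> h p \<le> h q" by auto
  have "h p > 0"
    using p by (cases p) (auto simp: h dest!: unit_circle_pencil_injective[OF M])
  have "norm (resolvent M \<omega> *v v) \<le> 1 / h p * norm v" if \<omega>: "\<omega> \<in> {0..2 * pi}" for \<omega> v
  proof (cases "resolvent M \<omega> *v v = 0")
    case False
    define u where "u = resolvent M \<omega> *v v"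
    let ?Z = "mat (exp (\<i> * complex_of_real \<omega>)) - complex_matrix M"
    have v: "v = ?Z *v u"
      by (simp add: u_def matrix_vector_mul_assoc resolvent_inverse[OF M])
    have "h p \<le> h (\<omega>, u /\<^sub>R norm u)" using \<omega> False by (intro mn) (auto simp: u_def)
    also have "\<dots> = norm (?Z *v u) / norm u"
      by (simp add: h linear_scale[OF matrix_vector_mul_linear] divide_inverse mult.commute)
    finally show ?thesis
      using False \<open>h p > 0\<close> by (simp add: field_simps flip: v u_def)
  qed (use \<open>h p > 0\<close> in simp)
  then show ?thesis using \<open>h p > 0\<close> by (intro exI[of _ "1 / h p"]) auto
qed

text \<open>
  The frequency difference of the resolvent and its boundedness make the gain Lipschitz in
  \<open>exp (\<i> * \<omega>)\<close>.
\<close>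

lemma continuous_on_sigma_max_resolvent:
  fixes L :: "complex^'n^'m" and N :: "complex^'k^'n"
  assumes M: "schur_stable M"
  shows "continuous_on {0..2 * pi} (\<lambda>\<omega>. sigma_max (L ** resolvent M \<omega> ** N))"
proof -
  obtain c where c: "c \<ge> 0"
    and cb: "\<And>\<omega> v. \<omega> \<in> {0..2 * pi} \<Longrightarrow> norm (resolvent M \<omega> *v v) \<le> c * norm v"
    using resolvent_bounded[OF M] by blast
  have res: "sigma_max (resolvent M \<omega>) \<le> c" if "\<omega> \<in> {0..2 * pi}" for \<omega>
    using cb[OF that] by (rule sigma_max_le)
  define \<phi> where "\<phi> = (\<lambda>\<omega>. exp (\<i> * complex_of_real \<omega>))"
  let ?f = "\<lambda>\<omega>. sigma_max (L ** resolvent M \<omega> ** N)"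
  define C where "C = sigma_max L * (c * c) * sigma_max N"
  have lip: "\<bar>?f \<omega> - ?f \<theta>\<bar> \<le> C * norm (\<phi> \<omega> - \<phi> \<theta>)"
    if \<omega>: "\<omega> \<in> {0..2 * pi}" and \<theta>: "\<theta> \<in> {0..2 * pi}" for \<omega> \<theta>
  proof -
    have "\<bar>?f \<omega> - ?f \<theta>\<bar> \<le> sigma_max (L ** resolvent M \<omega> ** N - L ** resolvent M \<theta> ** N)"
      by (rule abs_sigma_max_diff_le)
    also have "L ** resolvent M \<omega> ** N - L ** resolvent M \<theta> ** N
        = L ** (resolvent M \<omega> - resolvent M \<theta>) ** N"
      by (simp only: matrix_mult_diff_left matrix_mult_diff_right)
    also have "\<dots> = L ** (resolvent M \<omega> ** (mat (\<phi> \<theta> - \<phi> \<omega>) ** resolvent M \<theta>)) ** N"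
      unfolding resolvent_frequency_difference[OF M] \<phi>_def by (simp only: matrix_mul_assoc)
    also have "sigma_max \<dots> \<le> sigma_max L * (c * (norm (\<phi> \<theta> - \<phi> \<omega>) * c)) * sigma_max N"
      by (intro order_trans[OF sigma_max_mult_le] mult_mono order_refl sigma_max_nonneg
          mult_nonneg_nonneg norm_ge_zero c res \<omega> \<theta> sigma_max_mat_le)
    finally show ?thesis by (simp add: C_def norm_minus_commute mult_ac)
  qed
  show ?thesis
    unfolding continuous_on_def
  proof
    fix \<theta> assume \<theta>: "\<theta> \<in> {0..2 * pi}"
    have "((\<lambda>\<omega>. C * norm (\<phi> \<omega> - \<phi> \<theta>)) \<longlongrightarrow> C * norm (\<phi> \<theta> - \<phi> \<theta>)) (at \<theta> within {0..2 * pi})"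
      unfolding \<phi>_def by (intro tendsto_intros)
    then have "((\<lambda>\<omega>. C * norm (\<phi> \<omega> - \<phi> \<theta>)) \<longlongrightarrow> 0) (at \<theta> within {0..2 * pi})" by simp
    moreover have "eventually (\<lambda>\<omega>. norm (?f \<omega> - ?f \<theta>) \<le> C * norm (\<phi> \<omega> - \<phi> \<theta>))
        (at \<theta> within {0..2 * pi})"
      using lip \<theta> by (auto simp: eventually_at_filter)
    ultimately have "((\<lambda>\<omega>. ?f \<omega> - ?f \<theta>) \<longlongrightarrow> 0) (at \<theta> within {0..2 * pi})"
      by (rule Lim_null_comparison[rotated])
    then show "(?f \<longlongrightarrow> ?f \<theta>) (at \<theta> within {0..2 * pi})" by (rule LIM_zero_cancel)
  qed
qed

section \<open>The cost and its sublevel sets\<close>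

lemma T_zw_resolvent:
  "T_zw A B Bw C Q R K \<omega> = complex_matrix (stack_rows (sqrt_matrix Q) (sqrt_matrix R ** K ** C)) **
     resolvent (A + B ** K ** C) \<omega> ** complex_matrix Bw"
  by (simp add: T_zw_def resolvent_def)

text \<open>
  Continuity of the gain on the compact frequency interval shows that the \<open>GREATEST\<close> in the
  definition of the cost exists.
\<close>

lemma hinf_cost_max:
  assumes "K \<in> stabilizing_gains A B C"
  shows hinf_cost_attained:
      "\<exists>\<omega>\<in>{0..2 * pi}. hinf_cost A B Bw C Q R K = sigma_max (T_zw A B Bw C Q R K \<omega>)"
    and hinf_cost_upper:
      "\<omega> \<in> {0..2 * pi} \<Longrightarrow> sigma_max (T_zw A B Bw C Q R K \<omega>) \<le> hinf_cost A B Bw C Q R K"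
proof -
  let ?f = "\<lambda>\<omega>. sigma_max (T_zw A B Bw C Q R K \<omega>)"
  have st: "schur_stable (A + B ** K ** C)" using assms by (simp add: stabilizing_gains_def)
  have cont: "continuous_on {0..2 * pi} ?f"
    unfolding T_zw_resolvent by (rule continuous_on_sigma_max_resolvent[OF st])
  have "{0..2 * pi} \<noteq> {}" by simp
  from continuous_attains_sup[OF compact_Icc this cont]
  obtain \<theta> where \<theta>: "\<theta> \<in> {0..2 * pi}" "\<And>\<omega>. \<omega> \<in> {0..2 * pi} \<Longrightarrow> ?f \<omega> \<le> ?f \<theta>" by auto
  have J: "hinf_cost A B Bw C Q R K = ?f \<theta>"
    unfolding hinf_cost_def by (rule Greatest_equality) (use \<theta> in auto)
  show "\<exists>\<omega>\<in>{0..2 * pi}. hinf_cost A B Bw C Q R K = ?f \<omega>" using \<theta>(1) J by blast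
  show "?f \<omega> \<le> hinf_cost A B Bw C Q R K" if "\<omega> \<in> {0..2 * pi}"
    using \<theta>(2)[OF that] J by simp
qed

text \<open>
  The level \<open>\<nu>\<close> bounds the transfer function, and its factors are then cancelled one by one. A right
  inverse of \<open>Bw\<close> cancels the input matrix, which bounds the output matrix times the resolvent; the
  block \<open>sqrt_matrix Q\<close> of the output matrix is invertible, so cancelling it bounds the resolvent
  itself. The gain \<open>K\<close> does not enter the bounds.
\<close>

lemma sublevel_uniform_bounds:
  fixes A :: "real^'nx^'nx" and B :: "real^'nu^'nx" and Bw :: "real^'nw^'nx"
    and C :: "real^'nx^'ny" and Q :: "real^'nx^'nx" and R :: "real^'nu^'nu"
  assumes Bw: "full_row_rank Bw" and Q: "symmetric_matrix Q" "pos_definite Q" and "\<nu> > 0"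
  obtains x g where "x \<ge> 0" "g \<ge> 0"
    "\<And>K \<omega>. K \<in> hinf_sublevel A B Bw C Q R \<nu> \<Longrightarrow> \<omega> \<in> {0..2 * pi} \<Longrightarrow>
      sigma_max (complex_matrix (stack_rows (sqrt_matrix Q) (sqrt_matrix R ** K ** C)) **
        resolvent (A + B ** K ** C) \<omega>) \<le> x"
    "\<And>K \<omega>. K \<in> hinf_sublevel A B Bw C Q R \<nu> \<Longrightarrow> \<omega> \<in> {0..2 * pi} \<Longrightarrow>
      sigma_max (resolvent (A + B ** K ** C) \<omega>) \<le> g"
proof -
  let ?S = "sqrt_matrix Q"
  obtain W where W: "Bw ** W = mat 1"
    using Bw unfolding full_row_rank_def full_rank_surjective
    by (metis matrix_right_invertible_surjective)
  have "v = 0" if "?S *v v = 0" for v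
  proof (rule ccontr)
    assume "v \<noteq> 0"
    then have "0 < v \<bullet> (Q *v v)" using Q by (simp add: pos_definite_def)
    moreover have "Q *v v = ?S *v (?S *v v)"
      by (simp add: matrix_vector_mul_assoc sqrt_matrix_pos_definite[OF Q])
    ultimately show False using that by simp
  qed
  then obtain S' where S': "S' ** ?S = mat 1"
    by (metis matrix_left_invertible_ker)
  define x where "x = \<nu> * sigma_max (complex_matrix W)"
  define g where "g = sigma_max (complex_matrix S') * x"
  have x: "x \<ge> 0" using \<open>\<nu> > 0\<close> by (simp add: x_def sigma_max_nonneg)
  have g: "g \<ge> 0" using x by (simp add: g_def sigma_max_nonneg)
  have LG: "sigma_max (complex_matrix (stack_rows ?S (sqrt_matrix R ** K ** C)) **
        resolvent (A + B ** K ** C) \<omega>) \<le> x"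
    if K: "K \<in> hinf_sublevel A B Bw C Q R \<nu>" and \<omega>: "\<omega> \<in> {0..2 * pi}" for K \<omega>
  proof -
    let ?LG = "complex_matrix (stack_rows ?S (sqrt_matrix R ** K ** C)) ** resolvent (A + B ** K ** C) \<omega>"
    have "?LG = ?LG ** (complex_matrix Bw ** complex_matrix W)"
      by (simp add: W complex_matrix_mat flip: complex_matrix_mult)
    also have "\<dots> = T_zw A B Bw C Q R K \<omega> ** complex_matrix W"
      by (simp add: T_zw_resolvent matrix_mul_assoc)
    also have "sigma_max \<dots> \<le> sigma_max (T_zw A B Bw C Q R K \<omega>) * sigma_max (complex_matrix W)"
      by (rule sigma_max_mult_le)
    also have "\<dots> \<le> x"
      unfolding x_def
    proof (intro mult_right_mono sigma_max_nonneg)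
      have "sigma_max (T_zw A B Bw C Q R K \<omega>) \<le> hinf_cost A B Bw C Q R K"
        using K \<omega> by (intro hinf_cost_upper) (simp_all add: hinf_sublevel_def)
      then show "sigma_max (T_zw A B Bw C Q R K \<omega>) \<le> \<nu>" using K by (simp add: hinf_sublevel_def)
    qed
    finally show ?thesis .
  qed
  moreover have "sigma_max (resolvent (A + B ** K ** C) \<omega>) \<le> g"
    if K: "K \<in> hinf_sublevel A B Bw C Q R \<nu>" and \<omega>: "\<omega> \<in> {0..2 * pi}" for K \<omega>
  proof (rule sigma_max_le)
    fix v
    let ?G = "resolvent (A + B ** K ** C) \<omega>" and ?S' = "complex_matrix S'"
    let ?L = "complex_matrix (stack_rows ?S (sqrt_matrix R ** K ** C))"
    have "?G *v v = ?S' *v (complex_matrix ?S *v (?G *v v))"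
      by (simp add: matrix_vector_mul_assoc matrix_mul_assoc S' complex_matrix_mat flip: complex_matrix_mult)
    then have "norm (?G *v v) \<le> sigma_max ?S' * norm (complex_matrix ?S *v (?G *v v))"
      by (metis norm_le_sigma_max)
    also have "\<dots> \<le> sigma_max ?S' * norm (?L *v (?G *v v))"
      unfolding complex_matrix_stack_rows
      by (intro mult_left_mono norm_le_norm_stack_rows sigma_max_nonneg)
    also have "\<dots> \<le> sigma_max ?S' * (sigma_max (?L ** ?G) * norm v)"
      unfolding matrix_vector_mul_assoc
      by (intro mult_left_mono norm_le_sigma_max sigma_max_nonneg)
    also have "\<dots> \<le> sigma_max ?S' * (x * norm v)"
      by (intro mult_left_mono mult_right_mono LG K \<omega> sigma_max_nonneg norm_ge_zero)
    finally show "norm (?G *v v) \<le> g * norm v" by (simp add: g_def mult.assoc)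
  qed
  ultimately show thesis by (rule that[OF x g])
qed

section \<open>Weak convexity\<close>

text \<open>
  The algebraic heart of the proof. Along a segment with end points \<open>1\<close>, \<open>2\<close> and the point \<open>t\<close> in
  between, the output matrix \<open>L\<close> is affine with direction \<open>D\<close>, and \<open>G\<close> satisfies the resolvent
  identity with direction \<open>F\<close>. The deviation of \<open>L ** G\<close> from its chord then carries the factor
  \<open>t * (1 - t)\<close> and two factors of the direction. The right-hand side is arranged so that
  \<open>L\<close> occurs only in the product \<open>L1 ** G1\<close>: the transfer function bounds that product, while \<open>L\<close>
  alone can grow with the gain.
\<close>

lemma segment_output_identity:
  fixes L1 L2 Lt D :: "complex^'n^'m" and G1 G2 Gt F :: "complex^'n^'n" and t :: real
  assumes L1: "L1 = Lt + t *\<^sub>R D" and L2: "L2 = Lt - (1 - t) *\<^sub>R D"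
    and G1: "G1 - Gt = t *\<^sub>R (G1 ** F ** Gt)"
    and G2: "G2 - Gt = - (1 - t) *\<^sub>R (G2 ** F ** Gt)"
    and G12: "G1 - G2 = G1 ** F ** G2"
  shows "(1 - t) *\<^sub>R (L1 ** G1) + t *\<^sub>R (L2 ** G2) - Lt ** Gt
    = (t * (1 - t)) *\<^sub>R ((D + L1 ** G1 ** F) ** G2 ** F ** Gt)"
proof -
  have "L1 ** G1 - Lt ** Gt = (L1 - Lt) ** Gt + L1 ** (G1 - Gt)"
    by (simp add: matrix_mult_diff_left matrix_mult_diff_right)
  also have "\<dots> = t *\<^sub>R (D ** Gt + L1 ** G1 ** F ** Gt)"
    unfolding G1 by (simp add: L1 matrix_mult_scaleR_left matrix_mult_scaleR_right
        matrix_mul_assoc scaleR_add_right)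
  finally have 1: "L1 ** G1 - Lt ** Gt = t *\<^sub>R (D ** Gt + L1 ** G1 ** F ** Gt)" .
  have "L2 ** G2 - Lt ** Gt = (L2 - Lt) ** Gt + L2 ** (G2 - Gt)"
    by (simp add: matrix_mult_diff_left matrix_mult_diff_right)
  also have "L2 - Lt = - (1 - t) *\<^sub>R D" unfolding L2 scaleR_minus_left by simp
  also have "(- (1 - t) *\<^sub>R D) ** Gt + L2 ** (G2 - Gt)
      = - (1 - t) *\<^sub>R (D ** Gt + L2 ** G2 ** F ** Gt)"
    unfolding G2 matrix_mult_scaleR_left matrix_mult_scaleR_right scaleR_add_right matrix_mul_assoc ..
  finally have 2: "L2 ** G2 - Lt ** Gt = - (1 - t) *\<^sub>R (D ** Gt + L2 ** G2 ** F ** Gt)" .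
  have "L1 - L2 = t *\<^sub>R D + (1 - t) *\<^sub>R D" by (simp add: L1 L2)
  also have "\<dots> = D" by (simp flip: scaleR_add_left)
  finally have D: "L1 - L2 = D" .
  have "L1 ** G1 - L2 ** G2 = (L1 - L2) ** G2 + L1 ** (G1 - G2)"
    by (simp add: matrix_mult_diff_left matrix_mult_diff_right)
  also have "\<dots> = (D + L1 ** G1 ** F) ** G2"
    by (simp add: G12 D matrix_mult_add_left matrix_mul_assoc)
  finally have 3: "L1 ** G1 - L2 ** G2 = (D + L1 ** G1 ** F) ** G2" .
  \<comment> \<open>The \<open>D ** Gt\<close> parts of \<open>1\<close> and \<open>2\<close> cancel, leaving a difference of end point values, which
    contributes the second factor of the direction.\<close>
  have "(1 - t) *\<^sub>R (L1 ** G1) + t *\<^sub>R (L2 ** G2) - Lt ** Gt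
      = (1 - t) *\<^sub>R (L1 ** G1 - Lt ** Gt) + t *\<^sub>R (L2 ** G2 - Lt ** Gt)"
    by (simp add: algebra_simps)
  also have "\<dots> = (t * (1 - t)) *\<^sub>R ((L1 ** G1 - L2 ** G2) ** F ** Gt)"
    unfolding 1 2 by (simp add: matrix_mult_diff_left algebra_simps)
  also have "\<dots> = (t * (1 - t)) *\<^sub>R ((D + L1 ** G1 ** F) ** G2 ** F ** Gt)"
    unfolding 3 ..
  finally show ?thesis .
qed

text \<open>
  On the sublevel set the cost fails to be convex along a segment by at most a fixed multiple of
  \<open>t * (1 - t) * (norm (K1 - K2))\<^sup>2\<close>. At each frequency \<open>segment_output_identity\<close> gives this for the
  transfer function, with a constant made of the uniform bounds alone; \<^const>\<open>sigma_max\<close> is convex,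
  and the maximum over the frequencies preserves the estimate. Besides the end points, the
  intermediate gain must lie in the sublevel set, since its resolvent enters the error term.
\<close>

lemma hinf_cost_segment_bound:
  fixes A :: "real^'nx^'nx" and B :: "real^'nu^'nx" and Bw :: "real^'nw^'nx"
    and C :: "real^'nx^'ny" and Q :: "real^'nx^'nx" and R :: "real^'nu^'nu"
  assumes Bw: "full_row_rank Bw" and Q: "symmetric_matrix Q" "pos_definite Q" and "\<nu> > 0"
  obtains c where "c \<ge> 0"
    "\<And>t K1 K2. 0 < t \<Longrightarrow> t < 1 \<Longrightarrow> K1 \<in> hinf_sublevel A B Bw C Q R \<nu> \<Longrightarrow>
      K2 \<in> hinf_sublevel A B Bw C Q R \<nu> \<Longrightarrow>
      (1 - t) *\<^sub>R K1 + t *\<^sub>R K2 \<in> hinf_sublevel A B Bw C Q R \<nu> \<Longrightarrow>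
      hinf_cost A B Bw C Q R ((1 - t) *\<^sub>R K1 + t *\<^sub>R K2)
        \<le> (1 - t) * hinf_cost A B Bw C Q R K1 + t * hinf_cost A B Bw C Q R K2
          + t * (1 - t) * (c * (norm (K1 - K2))\<^sup>2)"
proof -
  let ?KK = "hinf_sublevel A B Bw C Q R \<nu>" and ?J = "hinf_cost A B Bw C Q R"
  let ?T = "T_zw A B Bw C Q R"
  define L where "L = (\<lambda>K. complex_matrix (stack_rows (sqrt_matrix Q) (sqrt_matrix R ** K ** C)))"
  define G where "G = (\<lambda>K. resolvent (A + B ** K ** C))"
  define D where "D = (\<lambda>E. complex_matrix (stack_rows (0 :: real^'nx^'nx) (sqrt_matrix R ** E ** C)))"
  define F where "F = (\<lambda>E. complex_matrix (B ** E ** C))"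
  obtain x g where xg: "x \<ge> 0" "g \<ge> 0"
    and x: "\<And>K \<omega>. K \<in> ?KK \<Longrightarrow> \<omega> \<in> {0..2 * pi} \<Longrightarrow> sigma_max (L K ** G K \<omega>) \<le> x"
    and g: "\<And>K \<omega>. K \<in> ?KK \<Longrightarrow> \<omega> \<in> {0..2 * pi} \<Longrightarrow> sigma_max (G K \<omega>) \<le> g"
    using sublevel_uniform_bounds[OF Bw Q \<open>\<nu> > 0\<close>, of A B C R] unfolding L_def G_def by metis
  have mmul: "M ** (c *\<^sub>R E) ** N = c *\<^sub>R (M ** E ** N)"
    for c and M :: "real^'p^'q" and E :: "real^'r^'p" and N :: "real^'s^'r"
    by (simp add: matrix_mult_scaleR_left matrix_mult_scaleR_right)
  have madd: "M ** (E + E') ** N = M ** E ** N + M ** E' ** N"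
    for M :: "real^'p^'q" and E E' :: "real^'r^'p" and N :: "real^'s^'r"
    by (simp add: matrix_add_ldistrib matrix_mult_add_left)
  \<comment> \<open>Both perturbations are linear in the gain direction, so their sizes are at most proportional to
    its norm.\<close>
  have "linear D"
  proof (rule linearI)
    fix E E' :: "real^'ny^'nu" and r :: real
    have "stack_rows (0 :: real^'nx^'nx) (sqrt_matrix R ** (E + E') ** C)
        = stack_rows 0 (sqrt_matrix R ** E ** C) + stack_rows 0 (sqrt_matrix R ** E' ** C)"
      using stack_rows_add[of "0 :: real^'nx^'nx" 0] by (simp add: madd)
    then show "D (E + E') = D E + D E'" by (simp add: D_def complex_matrix_add)
    have "stack_rows (0 :: real^'nx^'nx) (sqrt_matrix R ** (r *\<^sub>R E) ** C)
        = r *\<^sub>R stack_rows 0 (sqrt_matrix R ** E ** C)"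
      using stack_rows_scaleR[of r "0 :: real^'nx^'nx"] by (simp add: mmul)
    then show "D (r *\<^sub>R E) = r *\<^sub>R D E" by (simp add: D_def complex_matrix_scaleR)
  qed
  then obtain d where d0: "d \<ge> 0" and d: "\<And>E. sigma_max (D E) \<le> d * norm E"
    using sigma_max_linear_bounded by blast
  have "linear F"
    by (auto simp: F_def mmul madd complex_matrix_add complex_matrix_scaleR intro!: linearI)
  then obtain f where f0: "f \<ge> 0" and f: "\<And>E. sigma_max (F E) \<le> f * norm E"
    using sigma_max_linear_bounded by blast
  define b where "b = sigma_max (complex_matrix Bw)"
  define c where "c = (d + x * f) * g * f * g * b"
  have c0: "c \<ge> 0" using xg d0 f0 by (simp add: c_def b_def sigma_max_nonneg)
  have step: "?J ((1 - t) *\<^sub>R K1 + t *\<^sub>R K2)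
      \<le> (1 - t) * ?J K1 + t * ?J K2 + t * (1 - t) * (c * (norm (K1 - K2))\<^sup>2)"
    if t: "0 < t" "t < 1" and K: "K1 \<in> ?KK" "K2 \<in> ?KK" "(1 - t) *\<^sub>R K1 + t *\<^sub>R K2 \<in> ?KK"
    for t K1 K2
  proof -
    define Kt E where "Kt = (1 - t) *\<^sub>R K1 + t *\<^sub>R K2" and "E = K1 - K2"
    note KK = K(1,2) K(3)[folded Kt_def]
    have st: "K \<in> stabilizing_gains A B C" "schur_stable (A + B ** K ** C)" if "K \<in> ?KK" for K
      using that by (simp_all add: hinf_sublevel_def stabilizing_gains_def)
    have K1: "K1 = Kt + t *\<^sub>R E" and K2: "K2 = Kt + (- (1 - t)) *\<^sub>R E" and K12: "K1 = K2 + 1 *\<^sub>R E"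
      by (simp_all add: Kt_def E_def algebra_simps)
    have L: "L (K + s *\<^sub>R E) = L K + s *\<^sub>R D E" for K s
      using stack_rows_add[of "sqrt_matrix Q" 0 "sqrt_matrix R ** K ** C" "s *\<^sub>R (sqrt_matrix R ** E ** C)"]
        stack_rows_scaleR[of s "0 :: real^'nx^'nx" "sqrt_matrix R ** E ** C"]
      by (simp add: L_def D_def madd mmul flip: complex_matrix_add complex_matrix_scaleR)
    have G: "G (K + s *\<^sub>R E) \<omega> - G K \<omega> = s *\<^sub>R (G (K + s *\<^sub>R E) \<omega> ** F E ** G K \<omega>)"
      if "K \<in> ?KK" "K + s *\<^sub>R E \<in> ?KK" for K s \<omega>
      using resolvent_identity[OF st(2)[OF that(2)] st(2)[OF that(1)], of \<omega>]
      by (simp add: G_def F_def madd mmul complex_matrix_scaleR matrix_mult_scaleR_left matrix_mult_scaleR_right)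
    have T: "?T K \<omega> = L K ** G K \<omega> ** complex_matrix Bw" for K \<omega>
      by (simp add: T_zw_resolvent L_def G_def)
    have bound: "sigma_max (?T Kt \<omega>) \<le> (1 - t) * ?J K1 + t * ?J K2 + t * (1 - t) * (c * (norm E)\<^sup>2)"
      if \<omega>: "\<omega> \<in> {0..2 * pi}" for \<omega>
    proof -
      let ?e = "(D E + L K1 ** G K1 \<omega> ** F E) ** G K2 \<omega> ** F E ** G Kt \<omega> ** complex_matrix Bw"
      have "(1 - t) *\<^sub>R (L K1 ** G K1 \<omega>) + t *\<^sub>R (L K2 ** G K2 \<omega>) - L Kt ** G Kt \<omega>
          = (t * (1 - t)) *\<^sub>R ((D E + L K1 ** G K1 \<omega> ** F E) ** G K2 \<omega> ** F E ** G Kt \<omega>)"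
      proof (rule segment_output_identity)
        show "L K1 = L Kt + t *\<^sub>R D E" using L[of Kt t] K1 by simp
        show "L K2 = L Kt - (1 - t) *\<^sub>R D E"
          using L[of Kt "- (1 - t)"] K2
          by (simp only: scaleR_minus_left diff_conv_add_uminus)
        show "G K1 \<omega> - G Kt \<omega> = t *\<^sub>R (G K1 \<omega> ** F E ** G Kt \<omega>)"
          using G[of Kt t \<omega>] KK K1 by simp
        show "G K2 \<omega> - G Kt \<omega> = - (1 - t) *\<^sub>R (G K2 \<omega> ** F E ** G Kt \<omega>)"
          using G[of Kt "- (1 - t)" \<omega>] KK K2 by metis
        show "G K1 \<omega> - G K2 \<omega> = G K1 \<omega> ** F E ** G K2 \<omega>"
          using G[of K2 1 \<omega>] KK K12 by simp
      qed
      then have "L Kt ** G Kt \<omega> = (1 - t) *\<^sub>R (L K1 ** G K1 \<omega>) + t *\<^sub>R (L K2 ** G K2 \<omega>)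
          + (- (t * (1 - t))) *\<^sub>R ((D E + L K1 ** G K1 \<omega> ** F E) ** G K2 \<omega> ** F E ** G Kt \<omega>)"
        by (simp add: algebra_simps)
      then have "?T Kt \<omega> = (1 - t) *\<^sub>R ?T K1 \<omega> + t *\<^sub>R ?T K2 \<omega> + (- (t * (1 - t))) *\<^sub>R ?e"
        by (simp only: T matrix_mult_add_left matrix_mult_scaleR_left)
      from arg_cong[OF this, of sigma_max]
      have "sigma_max (?T Kt \<omega>) \<le> sigma_max ((1 - t) *\<^sub>R ?T K1 \<omega>) + sigma_max (t *\<^sub>R ?T K2 \<omega>)
          + sigma_max ((- (t * (1 - t))) *\<^sub>R ?e)"
        by (rule ord_eq_le_trans) (rule order_trans[OF sigma_max_add_le add_right_mono[OF sigma_max_add_le]])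
      also have "\<dots> = (1 - t) * sigma_max (?T K1 \<omega>) + t * sigma_max (?T K2 \<omega>) + t * (1 - t) * sigma_max ?e"
        using t by (simp only: sigma_max_scaleR) (simp add: abs_mult)
      also have "\<dots> \<le> (1 - t) * ?J K1 + t * ?J K2 + t * (1 - t) * (c * (norm E)\<^sup>2)"
      proof (intro add_mono mult_left_mono)
        show "sigma_max (?T K1 \<omega>) \<le> ?J K1" "sigma_max (?T K2 \<omega>) \<le> ?J K2"
          using st(1) KK \<omega> by (auto intro: hinf_cost_upper)
        have "sigma_max ?e \<le> (d * norm E + x * (f * norm E)) * g * (f * norm E) * g * b"
          unfolding b_def
          by (intro order_trans[OF sigma_max_mult_le] order_trans[OF sigma_max_add_le] mult_mono add_mono
              order_refl sigma_max_nonneg mult_nonneg_nonneg add_nonneg_nonneg norm_ge_zero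
              xg d0 f0 x g d f KK \<omega>)
        then show "sigma_max ?e \<le> c * (norm E)\<^sup>2"
          by (simp add: c_def algebra_simps power2_eq_square)
      qed (use t in auto)
      finally show ?thesis .
    qed
    \<comment> \<open>Evaluate at a frequency where the cost of \<open>Kt\<close> is attained.\<close>
    obtain \<omega> where "\<omega> \<in> {0..2 * pi}" "?J Kt = sigma_max (?T Kt \<omega>)"
      using hinf_cost_attained[OF st(1)[OF KK(3)]] by blast
    with bound show ?thesis unfolding Kt_def E_def by simp
  qed
  show thesis by (rule that[OF c0 step])
qed

text \<open>
  The squared norm is strongly convex with exactly the defect that has to be compensated.
\<close>

lemma norm_convex_combination_squared:
  fixes x y :: "'a::real_inner"
  shows "(norm ((1 - t) *\<^sub>R x + t *\<^sub>R y))\<^sup>2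
    = (1 - t) * (norm x)\<^sup>2 + t * (norm y)\<^sup>2 - t * (1 - t) * (norm (x - y))\<^sup>2"
  unfolding power2_norm_eq_inner
  by (simp add: inner_add_left inner_add_right inner_diff_left inner_diff_right inner_commute[of y x])
    (simp add: algebra_simps)

theorem theorem1:
  fixes A :: "real^'nx^'nx" and B :: "real^'nu^'nx" and Bw :: "real^'nw^'nx"
    and C :: "real^'nx^'ny" and Q :: "real^'nx^'nx" and R :: "real^'nu^'nu"
    and \<nu> :: real
  assumes "stabilizable A B"
    and "full_row_rank Bw" and "full_row_rank C"
    and "symmetric_matrix Q" and "pos_definite Q"
    and "symmetric_matrix R" and "pos_definite R"
    and "stabilizing_gains A B C \<noteq> {}"
    and "\<nu> > 0"
    and "hinf_sublevel A B Bw C Q R \<nu> \<noteq> {}"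
  shows "\<exists>m > 0. \<forall>V. V \<subseteq> hinf_sublevel A B Bw C Q R \<nu> \<and> V \<noteq> {} \<and> convex V \<longrightarrow>
           convex_on V (\<lambda>K. hinf_cost A B Bw C Q R K + m / 2 * (norm K)\<^sup>2)"
proof -
  let ?KK = "hinf_sublevel A B Bw C Q R \<nu>" and ?J = "hinf_cost A B Bw C Q R"
  obtain c where c0: "c \<ge> 0"
    and c: "\<And>t K1 K2. 0 < t \<Longrightarrow> t < 1 \<Longrightarrow> K1 \<in> ?KK \<Longrightarrow> K2 \<in> ?KK \<Longrightarrow>
      (1 - t) *\<^sub>R K1 + t *\<^sub>R K2 \<in> ?KK \<Longrightarrow>
      ?J ((1 - t) *\<^sub>R K1 + t *\<^sub>R K2)
        \<le> (1 - t) * ?J K1 + t * ?J K2 + t * (1 - t) * (c * (norm (K1 - K2))\<^sup>2)"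
    using hinf_cost_segment_bound[OF assms(2,4,5,9), of A B C R] by metis
  \<comment> \<open>\<open>m = 2 * c\<close> already compensates the defect; the summand makes \<open>m\<close> positive even if \<open>c = 0\<close>.\<close>
  have half: "2 * (c + 1) / 2 = c + 1" by simp
  show ?thesis
  proof (intro exI[of _ "2 * (c + 1)"] conjI allI impI)
    show "0 < 2 * (c + 1)" using c0 by simp
    fix V assume V: "V \<subseteq> ?KK \<and> V \<noteq> {} \<and> convex V"
    show "convex_on V (\<lambda>K. ?J K + (2 * (c + 1)) / 2 * (norm K)\<^sup>2)"
    proof (rule convex_onI)
      fix t K1 K2 assume t: "0 < t" "t < (1::real)" and K: "K1 \<in> V" "K2 \<in> V"
      have "(1 - t) *\<^sub>R K1 + t *\<^sub>R K2 \<in> V"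
        using V K t by (intro convexD) auto
      then have "?J ((1 - t) *\<^sub>R K1 + t *\<^sub>R K2)
          \<le> (1 - t) * ?J K1 + t * ?J K2 + t * (1 - t) * (c * (norm (K1 - K2))\<^sup>2)"
        using V K t by (intro c) auto
      moreover have "0 \<le> t * (1 - t) * (norm (K1 - K2))\<^sup>2" using t by simp
      ultimately show "?J ((1 - t) *\<^sub>R K1 + t *\<^sub>R K2)
            + (2 * (c + 1)) / 2 * (norm ((1 - t) *\<^sub>R K1 + t *\<^sub>R K2))\<^sup>2
          \<le> (1 - t) * (?J K1 + (2 * (c + 1)) / 2 * (norm K1)\<^sup>2)
            + t * (?J K2 + (2 * (c + 1)) / 2 * (norm K2)\<^sup>2)"
        unfolding half norm_convex_combination_squared by (simp add: algebra_simps)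
    qed (use V in blast)
  qed
qed

end
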